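(* Let $\mathbb{F}$ be a field with $\mathrm{Char}(\mathbb{F})\ne2$. Let $a_0,a_1,x_1,\theta^*_0,\theta^*_1\in\mathbb{F}$ and consider the matrices in $\mathrm{Mat}_2(\mathbb{F})$ $$A=\begin{pmatrix}a_0&x_1\\1&a_1\end{pmatrix},\qquad B=\begin{pmatrix}0&x_1\\1&0\end{pmatrix},\qquad A^*=\begin{pmatrix}\theta^*_0&0\\0&\theta^*_1\end{pmatrix}.$$ Assume that the pair $A,A^*$ is a Leonard pair over $\mathbb{F}$. Then the following are equivalent: (i) $A,A^*$ is near-bipartite; (ii) $B,A^*$ is a Leonard pair over $\mathbb{F}$. Assume that (i) and (ii) hold. Then $B,A^*$ is the bipartite contraction of $A,A^*$.
   Context: A tridiagonal matrix is irreducible if all its subdiagonal and superdiagonal entries are nonzero. Let $V$ be a vector space over $\mathbb{F}$ of dimension $d+1$. A Leonard pair on $V$ (over $\mathbb{F}$) is an ordered pair $A,A^*$ in $\mathrm{End}(V)$ such that (a) some basis of $V$ makes the matrix of $A$ irreducible tridiagonal and that of $A^*$ diagonal; (b) some basis of $V$ makes the matrix of $A^*$ irreducible tridiagonal and that of $A$ diagonal. ($A^*$ is just a name, not an adjoint.) Here $V=\mathbb{F}^2$ and matrices act by left multiplication. Each of $A,A^*$ has $d+1$ distinct eigenvalues. Let $E^*_0,\dots,E^*_d$ be the primitive idempotents of $A^*$ (projections onto its eigenspaces along the sum of the other eigenspaces). The flat part of $A$ is $F=\sum_{i=0}^d E^*_i A E^*_i$. $A,A^*$ is near-bipartite if $A-F,A^*$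 is a Leonard pair on $V$; in that case $A-F,A^*$ is called the bipartite contraction of $A,A^*$. *)

theory Defs
  imports "HOL-Analysis.Analysis"
begin

text \<open>
  Square matrices of size \<open>d + 1\<close> are functions \<open>M :: nat \<Rightarrow> nat \<Rightarrow> 'a\<close> (row, column) of which only
  the entries with both indices in \<open>{..d}\<close> matter.
\<close>

definition diagonal_matrix :: "nat \<Rightarrow> (nat \<Rightarrow> nat \<Rightarrow> 'a::zero) \<Rightarrow> bool" where
  "diagonal_matrix d M \<longleftrightarrow> (\<forall>i\<le>d. \<forall>j\<le>d. i \<noteq> j \<longrightarrow> M i j = 0)"

definition tridiagonal_matrix :: "nat \<Rightarrow> (nat \<Rightarrow> nat \<Rightarrow> 'a::zero) \<Rightarrow> bool" where
  "tridiagonal_matrix d M \<longleftrightarrow> (\<forall>i\<le>d. \<forall>j\<le>d. i + 1 < j \<or> j + 1 < i \<longrightarrow> M i j = 0)"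

definition irreducible_tridiagonal :: "nat \<Rightarrow> (nat \<Rightarrow> nat \<Rightarrow> 'a::zero) \<Rightarrow> bool" where
  "irreducible_tridiagonal d M \<longleftrightarrow>
     tridiagonal_matrix d M \<and> (\<forall>i<d. M (i + 1) i \<noteq> 0 \<and> M i (i + 1) \<noteq> 0)"

text \<open>
  The prefix \<open>local.\<close> below avoids capture by the unqualified names that the library's
  interpretation of \<open>vector_space\<close> by \<open>real_vector\<close> generates.
\<close>

context vector_space
begin

definition ordered_basis :: "nat \<Rightarrow> (nat \<Rightarrow> 'b) \<Rightarrow> bool" where
  "ordered_basis d v \<longleftrightarrow>
     inj_on v {..d} \<and> independent (v ` {..d}) \<and> span (v ` {..d}) = UNIV"

text \<open>Column \<open>j\<close> lists the coordinates of \<open>T (v j)\<close> in the basis \<open>v 0, \<dots>, v d\<close>.\<close>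

definition matrix_wrt :: "nat \<Rightarrow> (nat \<Rightarrow> 'b) \<Rightarrow> ('b \<Rightarrow> 'b) \<Rightarrow> nat \<Rightarrow> nat \<Rightarrow> 'a" where
  "matrix_wrt d v T i j = representation (v ` {..d}) (T (v j)) (v i)"

definition leonard_pair :: "('b \<Rightarrow> 'b) \<Rightarrow> ('b \<Rightarrow> 'b) \<Rightarrow> bool" where
  "leonard_pair A A' \<longleftrightarrow>
     Vector_Spaces.linear scale scale A \<and> Vector_Spaces.linear scale scale A' \<and>
     (\<exists>d. dim UNIV = d + 1 \<and>
       (\<exists>v. local.ordered_basis d v \<and>
            irreducible_tridiagonal d (local.matrix_wrt d v A) \<and>
            diagonal_matrix d (local.matrix_wrt d v A')) \<and>
       (\<exists>v. local.ordered_basis d v \<and>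
            irreducible_tridiagonal d (local.matrix_wrt d v A') \<and>
            diagonal_matrix d (local.matrix_wrt d v A)))"

definition eigenspace :: "('b \<Rightarrow> 'b) \<Rightarrow> 'a \<Rightarrow> 'b set" where
  "eigenspace T \<theta> = {v. T v = scale \<theta> v}"

definition eigenvalues :: "('b \<Rightarrow> 'b) \<Rightarrow> 'a set" where
  "eigenvalues T = {\<theta>. \<exists>v. v \<noteq> 0 \<and> T v = scale \<theta> v}"

text \<open>
  The projection onto the \<open>\<theta>\<close>-eigenspace along the sum of the other eigenspaces. It is
  meaningful only if \<open>T\<close> is diagonalizable, as both members of a Leonard pair are.
\<close>

definition primitive_idempotent :: "('b \<Rightarrow> 'b) \<Rightarrow> 'a \<Rightarrow> 'b \<Rightarrow> 'b" where
  "primitive_idempotent T \<theta> v =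
     (THE w. w \<in> local.eigenspace T \<theta> \<and>
             v - w \<in> span (\<Union>\<mu>\<in>local.eigenvalues T - {\<theta>}. local.eigenspace T \<mu>))"

text \<open>
  The primitive idempotents are indexed here by the eigenvalues of \<open>A'\<close> themselves rather than
  by an enumeration of them; the sum does not depend on the enumeration.
\<close>

definition flat_part :: "('b \<Rightarrow> 'b) \<Rightarrow> ('b \<Rightarrow> 'b) \<Rightarrow> 'b \<Rightarrow> 'b" where
  "flat_part A A' v =
     (\<Sum>\<theta>\<in>local.eigenvalues A'.
        local.primitive_idempotent A' \<theta> (A (local.primitive_idempotent A' \<theta> v)))"

definition near_bipartite :: "('b \<Rightarrow> 'b) \<Rightarrow> ('b \<Rightarrow> 'b) \<Rightarrow> bool" where
  "near_bipartite A A' \<longleftrightarrow>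
     local.leonard_pair A A' \<and> local.leonard_pair (\<lambda>v. A v - local.flat_part A A' v) A'"

definition is_bipartite_contraction ::
    "('b \<Rightarrow> 'b) \<Rightarrow> ('b \<Rightarrow> 'b) \<Rightarrow> ('b \<Rightarrow> 'b) \<Rightarrow> ('b \<Rightarrow> 'b) \<Rightarrow> bool" where
  "is_bipartite_contraction B B' A A' \<longleftrightarrow>
     local.near_bipartite A A' \<and> B = (\<lambda>v. A v - local.flat_part A A' v) \<and> B' = A'"

end

end

theory Submission
  imports Defs
begin

text \<open>
  If \<open>\<theta>0 = \<theta>1\<close> then \<open>A'\<close> is a scalar, hence diagonal in every basis, and cannot be part of a
  Leonard pair in dimension at least two. So the eigenvalues of \<open>A'\<close> are distinct, its primitive
  idempotents are the coordinate projections, and the flat part of \<open>A\<close> is the diagonal part of \<open>A\<close>.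
  Hence \<open>A - F = B\<close>.
\<close>

lemma (in vector_space) leonard_pair_not_scalar:
  assumes "local.leonard_pair A A'" and "dim UNIV \<noteq> 1"
  shows "A' \<noteq> (\<lambda>v. scale c v)"
proof
  assume A': "A' = (\<lambda>v. scale c v)"
  \<comment> \<open>The basis is the one from part (b). As \<open>d + 1\<close> differs from 1,
    \<open>d > 0\<close>, so there is a subdiagonal entry at \<open>(1, 0)\<close> to
    contradict.\<close>
  from assms obtain d v where d: "d > 0" and v: "local.ordered_basis d v"
    and irr: "irreducible_tridiagonal d (local.matrix_wrt d v A')"
    unfolding leonard_pair_def by force
  have inj: "inj_on v {..d}" and indep: "independent (v ` {..d})"
    using v by (auto simp: ordered_basis_def)
  have "v 1 \<noteq> v 0"
    using inj d by (auto simp: inj_on_def)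
  then have "local.matrix_wrt d v A' 1 0 = 0"
    using indep by (simp add: matrix_wrt_def A' representation_scale span_base representation_basis)
  with irr d show False
    by (auto simp: irreducible_tridiagonal_def)
qed

context
  fixes t :: "'n::finite \<Rightarrow> 'a::field" and D :: "'a ^ 'n ^ 'n"
  assumes inj: "inj t" and D: "D = (\<chi> i j. if i = j then t i else 0)"
begin

lemma diagonal_mult_vec: "D *v x = (\<chi> i. t i * x $ i)"
  by (simp add: D matrix_vector_mult_def vec_eq_iff if_distrib[of "\<lambda>a. a * _"] cong: if_cong)

text \<open>Coordinate \<open>j\<close> of the eigenvector equation is
  \<open>(t j - t i) * x $ j = 0\<close>, so injectivity of \<open>t\<close> kills every coordinate
  but the \<open>i\<close>-th.\<close>

lemma eigenspace_diagonal: "vec.eigenspace ((*v) D) (t i) = range (axis i)"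
proof (intro set_eqI iffI)
  fix x assume "x \<in> vec.eigenspace ((*v) D) (t i)"
  then have "t j * x $ j = t i * x $ j" for j
    by (simp add: vec.eigenspace_def diagonal_mult_vec vec_eq_iff)
  then have "x = axis i (x $ i)"
    using inj by (auto simp: vec_eq_iff axis_def inj_def)
  then show "x \<in> range (axis i)"
    by blast
qed (auto simp: vec.eigenspace_def diagonal_mult_vec vec_eq_iff axis_def)

lemma eigenvalues_diagonal: "vec.eigenvalues ((*v) D) = range t"
proof (intro set_eqI iffI)
  fix c assume "c \<in> vec.eigenvalues ((*v) D)"
  \<comment> \<open>A nonzero coordinate of the eigenvector can be cancelled from
    \<open>t i * x $ i = c * x $ i\<close>.\<close>
  then obtain x i where "x $ i \<noteq> 0" "D *v x = c *s x"
    by (auto simp: vec.eigenvalues_def vec_eq_iff)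
  then have "c = t i"
    by (auto simp: diagonal_mult_vec vec_eq_iff)
  then show "c \<in> range t"
    by blast
next
  fix c assume "c \<in> range t"
  then obtain i where "c = t i"
    by blast
  then have "axis i 1 \<noteq> (0::'a^'n) \<and> D *v axis i 1 = c *s axis i 1"
    by (auto simp: diagonal_mult_vec vec_eq_iff axis_def)
  then show "c \<in> vec.eigenvalues ((*v) D)"
    unfolding vec.eigenvalues_def by blast
qed

text \<open>The other eigenspaces are the coordinate axes \<open>j\<close> with \<open>j\<close>
  different from \<open>i\<close>, and these generate the \<open>i\<close>-th coordinate
  hyperplane.\<close>

lemma span_other_eigenspaces_diagonal:
  "vec.span (\<Union>\<mu>\<in>vec.eigenvalues ((*v) D) - {t i}. vec.eigenspace ((*v) D) \<mu>) = {x. x $ i = 0}"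
    (is "vec.span ?U = ?S")
proof (rule vec.span_unique)
  have "range t - {t i} = t ` (- {i})"
    using inj by (auto simp: inj_def)
  then have U: "?U = (\<Union>j\<in>- {i}. range (axis j))"
    by (simp add: eigenvalues_diagonal eigenspace_diagonal)
  show "?U \<subseteq> ?S"
    unfolding U by (auto simp: axis_def)
  show "vec.subspace ?S"
    by (auto simp: vec.subspace_def)
  fix S' assume S': "?U \<subseteq> S'" "vec.subspace S'"
  show "?S \<subseteq> S'"
  proof
    fix x :: "'a^'n" assume x: "x \<in> ?S"
    \<comment> \<open>The missing \<open>i\<close>-th term of the coordinate expansion is zero,
      since \<open>x\<close> lies in the hyperplane.\<close>
    have "x = (\<Sum>j\<in>- {i}. axis j (x $ j))"
      using x by (auto simp: vec_eq_iff axis_def sum.delta)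
    moreover have "(\<Sum>j\<in>- {i}. axis j (x $ j)) \<in> S'"
      using S' unfolding U by (intro vec.subspace_sum) auto
    ultimately show "x \<in> S'"
      by simp
  qed
qed

text \<open>A vector \<open>w = axis i c\<close> has \<open>x - w\<close> in the hyperplane exactly
  when \<open>c = x $ i\<close>, so the definite description has a unique solution.\<close>

lemma primitive_idempotent_diagonal:
  "vec.primitive_idempotent ((*v) D) (t i) x = axis i (x $ i)"
  unfolding vec.primitive_idempotent_def span_other_eigenspaces_diagonal eigenspace_diagonal
  by (rule the_equality) auto

lemma flat_part_diagonal:
  "vec.flat_part ((*v) A) ((*v) D) x = (\<chi> i. A $ i $ i * x $ i)"
proof -
  have "(A *v axis i (x $ i)) $ i = A $ i $ i * x $ i" for i
    by (simp add: matrix_vector_mult_def axis_def if_distrib[of "\<lambda>a. _ * a"] cong: if_cong)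
  \<comment> \<open>Injectivity of \<open>t\<close> turns the sum over eigenvalues into a sum over
    indices.\<close>
  then have "vec.flat_part ((*v) A) ((*v) D) x = (\<Sum>i\<in>UNIV. axis i (A $ i $ i * x $ i))"
    by (simp add: vec.flat_part_def eigenvalues_diagonal sum.reindex[OF inj]
        primitive_idempotent_diagonal)
  also have "\<dots> = (\<chi> i. A $ i $ i * x $ i)"
    by (simp add: vec_eq_iff axis_def)
  finally show ?thesis .
qed

end

theorem proposition9p3:
  fixes a0 a1 x1 \<theta>0 \<theta>1 :: "'a::field"
    and A B A' :: "'a ^ 2 ^ 2"
  assumes "CHAR('a) \<noteq> 2"
    and "A = vector [vector [a0, x1], vector [1, a1]]"
    and "B = vector [vector [0, x1], vector [1, 0]]"
    and "A' = vector [vector [\<theta>0, 0], vector [0, \<theta>1]]"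
    and "vec.leonard_pair ((*v) A) ((*v) A')"
  shows "(vec.near_bipartite ((*v) A) ((*v) A') \<longleftrightarrow> vec.leonard_pair ((*v) B) ((*v) A')) \<and>
    (vec.near_bipartite ((*v) A) ((*v) A') \<and> vec.leonard_pair ((*v) B) ((*v) A') \<longrightarrow>
      vec.is_bipartite_contraction ((*v) B) ((*v) A') ((*v) A) ((*v) A'))"
proof -
  have "(*v) A' \<noteq> (\<lambda>v. \<theta>0 *s v)"
    using assms(5) by (rule vec.leonard_pair_not_scalar) (simp add: vec_dim_card del: vec.dim_UNIV)
  then have "\<theta>0 \<noteq> \<theta>1"
    by (auto simp: assms(4) fun_eq_iff vec_eq_iff matrix_vector_mult_def forall_2 sum_2)
  \<comment> \<open>This function lists the diagonal of \<open>A'\<close> and serves as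
    \<open>t\<close>.\<close>
  then have "inj (\<lambda>i::2. if i = 1 then \<theta>0 else \<theta>1)"
    by (simp add: inj_def forall_2)
  moreover have "A' = (\<chi> i j. if i = j then (if i = 1 then \<theta>0 else \<theta>1) else 0)"
    by (simp add: assms(4) vec_eq_iff forall_2)
  ultimately have "vec.flat_part ((*v) A) ((*v) A') x = (\<chi> i. A $ i $ i * x $ i)" for x
    by (rule flat_part_diagonal)
  \<comment> \<open>With \<open>A - F\<close> equal to \<open>B\<close> as a map, (i) and (ii)
    become the same condition and the contraction claim holds by definition.\<close>
  then have "(\<lambda>v. A *v v - vec.flat_part ((*v) A) ((*v) A') v) = (*v) B"
    by (simp add: assms(2,3) fun_eq_iff vec_eq_iff matrix_vector_mult_def forall_2 sum_2)
  with assms(5) show ?thesis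
    by (simp add: vec.near_bipartite_def vec.is_bipartite_contraction_def)
qed

end
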